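(* Let $(X,G)$ be a CR-dynamical system. Consider the following statements. (1) $(X,G)$ is transitive, i.e. for all non-empty open sets $U$ and $V$ in $X$ there is a non-negative integer $n$ such that $G^{n}(U)\cap V\neq\emptyset$. (2) For all non-empty open sets $U$ and $V$ in $X$ there is a positive integer $n$ such that $G^{n}(U)\cap V\neq\emptyset$. (3) For each non-empty open set $U$ in $X$, $\bigcup_{k=0}^{\infty}G^{k}(U)$ is dense in $X$. (4) For each non-empty open set $U$ in $X$, $\bigcup_{k=1}^{\infty}G^{k}(U)$ is dense in $X$. (5) For all non-empty open sets $U$ and $V$ in $X$ there is a non-negative integer $n$ such that $G^{-n}(U)\cap V\neq\emptyset$. (6) For all non-empty open sets $U$ and $V$ in $X$ there is a positive integer $n$ such that $G^{-n}(U)\cap V\neq\emptyset$. (7) For each non-empty open set $U$ in $X$, $\bigcup_{k=0}^{\infty}G^{-k}(U)$ is dense in $X$. (8) For each non-empty open set $U$ in $X$, $\bigcup_{k=1}^{\infty}G^{-k}(U)$ is dense in $X$. Then the following hold. (a) The statements (1), (3), (5) and (7) are equivalent. (b) The statements (2), (4), (6) and (8) are equivalent. (c) If $X$ has no isolated points, then all statements (1)–(8) are equivalent.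
   Context: A CR-dynamical system is a pair $(X,G)$ where $X$ is a non-empty compact metric space and $G$ is a closed relation on $X$, i.e. a non-empty closed subset of $X\times X$. For a positive integer $n$ and $x\in X$, $G^n(x)$ is the set of all $y\in X$ for which there are $x_1,\dots,x_{n+1}\in X$ with $x_1=x$, $x_{n+1}=y$ and $(x_i,x_{i+1})\in G$ for $1\le i\le n$; for $A\subseteq X$, $G^n(A)=\bigcup_{x\in A}G^n(x)$. With $G^{-1}=\{(y,x) : (x,y)\in G\}$, set $G^{-n}(A)=(G^{-1})^n(A)$ for each positive integer $n$. Also $G^0(A)=G^{-0}(A)=A$. *)

theory Defs
  imports "HOL-Analysis.Analysis"
begin

locale CR_dynamical_system = Metric_space X d
  for X :: "'a set" and d :: "'a \<Rightarrow> 'a \<Rightarrow> real" +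
  fixes G :: "('a \<times> 'a) set"
  assumes nonempty_space: "X \<noteq> {}"
    and compact: "compact_space mtopology"
    and nonempty_rel: "G \<noteq> {}"
    and closed_rel: "closedin (prod_topology mtopology mtopology) G"

text \<open>
  The set \<open>G\<^sup>n(A)\<close>. The points of a chain need not be required to lie in \<open>X\<close>: each of them is a
  component of a pair in \<open>G \<subseteq> X \<times> X\<close>. Negative powers \<open>G\<^sup>-\<^sup>n(A)\<close> are written
  \<open>iter_image (G\<inverse>) n A\<close>.
\<close>

definition iter_image :: "('a \<times> 'a) set \<Rightarrow> nat \<Rightarrow> 'a set \<Rightarrow> 'a set" where
  "iter_image G n A =
     (if n = 0 then A
      else (\<Union>x\<in>A. {y. \<exists>s :: nat \<Rightarrow> 'a. s 1 = x \<and> s (n + 1) = y \<and>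
                              (\<forall>i\<in>{1..n}. (s i, s (i + 1)) \<in> G)}))"

lemma iter_image_eq_relpow: "iter_image G n A = (G ^^ n) `` A"
proof (cases "n = 0")
  case True
  then show ?thesis by (simp add: iter_image_def)
next
  case False
  have "(\<exists>s :: nat \<Rightarrow> 'a. s 1 = x \<and> s (n + 1) = y \<and> (\<forall>i\<in>{1..n}. (s i, s (i + 1)) \<in> G))
          \<longleftrightarrow> (x, y) \<in> G ^^ n" (is "?L \<longleftrightarrow> ?R") for x y
  proof
    assume ?L
    then obtain s where s: "s 1 = x" "s (n + 1) = y" "\<forall>i\<in>{1..n}. (s i, s (i + 1)) \<in> G"
      by blast
    show ?R
      unfolding relpow_fun_conv using s by (intro exI[of _ "\<lambda>i. s (Suc i)"]) auto
  next
    assume ?R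
    then obtain f where f: "f 0 = x" "f n = y" "\<forall>i<n. (f i, f (Suc i)) \<in> G"
      unfolding relpow_fun_conv by blast
    have "(f (i - 1), f i) \<in> G" if "i \<in> {1..n}" for i
      using f(3)[rule_format, of "i - 1"] that by auto
    then show ?L
      using f(1,2) by (intro exI[of _ "\<lambda>i. f (i - 1)"]) auto
  qed
  with False show ?thesis by (auto simp: iter_image_def)
qed

context CR_dynamical_system
begin

definition CR_transitive :: bool where
  "CR_transitive \<longleftrightarrow>
     (\<forall>U V. openin mtopology U \<and> U \<noteq> {} \<and> openin mtopology V \<and> V \<noteq> {} \<longrightarrow>
            (\<exists>n. iter_image G n U \<inter> V \<noteq> {}))"

end

definition dense_in_space :: "'a topology \<Rightarrow> 'a set \<Rightarrow> bool" where
  "dense_in_space T S \<longleftrightarrow> T closure_of S = topspace T"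

definition no_isolated_points :: "'a topology \<Rightarrow> bool" where
  "no_isolated_points T \<longleftrightarrow> (\<forall>x\<in>topspace T. \<not> openin T {x})"

end

theory Submission
  imports Defs
begin

text \<open>
  All eight statements say that every non-empty open \<open>U\<close> is joined to every non-empty open \<open>V\<close> by a
  chain of \<open>G\<close>, and differ only in the lengths allowed (a set \<open>K\<close>, either all naturals or the
  positive ones) and in phrasing. For fixed \<open>K\<close> the phrasing is irrelevant: a set is dense iff it
  meets every non-empty open set (\<open>dense_iter_images_iff\<close>), and reading chains backwards exchanges
  \<open>U\<close> and \<open>V\<close>, which range over the same sets (\<open>open_sets_joined_converse_iff\<close>). This gives (a)
  and (b).

  For (c), length zero has to be avoided. If no point is isolated, any non-empty open set
  contains two disjoint non-empty open sets; a chain from one to the other has positive length. When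
  \<open>U\<close> and \<open>V\<close> meet, this is applied inside \<open>U \<inter> V\<close>; when they are disjoint, chains from \<open>U\<close> to \<open>V\<close>
  have positive length anyway (\<open>open_sets_joined_positive\<close>). The two disjoint sets come from
  separating two points in the metric topology, which is Hausdorff (\<open>disjoint_open_subsets\<close>).
\<close>

text \<open>
  The set \<open>K\<close> of allowed lengths is a parameter, so that the statements with non-negative and with
  positive lengths are the instances \<open>UNIV\<close> and \<open>{0<..}\<close> of one notion.
\<close>

definition open_sets_joined :: "'a topology \<Rightarrow> nat set \<Rightarrow> ('a \<times> 'a) set \<Rightarrow> bool" where
  "open_sets_joined T K G \<longleftrightarrow>
     (\<forall>U V. openin T U \<and> U \<noteq> {} \<and> openin T V \<and> V \<noteq> {} \<longrightarrow>
        (\<exists>n\<in>K. iter_image G n U \<inter> V \<noteq> {}))"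

text \<open>
  Density of the union means that it meets each non-empty open \<open>V\<close>, and a union meets \<open>V\<close> iff one
  of its members does.
\<close>

lemma dense_iter_images_iff:
  "(\<forall>U. openin T U \<and> U \<noteq> {} \<longrightarrow> dense_in_space T (\<Union>k\<in>K. iter_image G k U))
     \<longleftrightarrow> open_sets_joined T K G"
  unfolding dense_in_space_def dense_intersects_open open_sets_joined_def by blast

lemma relpow_converse: "((R :: ('a \<times> 'a) set)\<inverse>) ^^ n = (R ^^ n)\<inverse>"
proof (induction n)
  case (Suc n)
  have "(R\<inverse>) ^^ Suc n = (R O R ^^ n)\<inverse>" by (simp add: Suc converse_relcomp)
  then show ?case by (simp add: relpow_commute)
qed simp

lemma iter_image_converse_meets_iff:
  "iter_image (G\<inverse>) n U \<inter> V \<noteq> {} \<longleftrightarrow> iter_image G n V \<inter> U \<noteq> {}"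
  unfolding iter_image_eq_relpow relpow_converse by blast

text \<open>
  Reversing a chain from \<open>V\<close> to \<open>U\<close> keeps its length, and the condition ranges over all ordered
  pairs of non-empty open sets, so interchanging \<open>U\<close> and \<open>V\<close> does not affect it.
\<close>

lemma open_sets_joined_converse_iff: "open_sets_joined T K (G\<inverse>) \<longleftrightarrow> open_sets_joined T K G"
  unfolding open_sets_joined_def iter_image_converse_meets_iff by blast

lemma iter_image_mono: "A \<subseteq> B \<Longrightarrow> iter_image G n A \<subseteq> iter_image G n B"
  unfolding iter_image_eq_relpow by blast

text \<open>
  A non-empty open set without isolated points has a second point, and separating neighbourhoods
  of two of its points can be cut down to it.
\<close>

lemma disjoint_open_subsets:
  assumes "Hausdorff_space T" "no_isolated_points T" "openin T W" "W \<noteq> {}"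
  obtains W1 W2 where "openin T W1" "W1 \<noteq> {}" "W1 \<subseteq> W"
    and "openin T W2" "W2 \<noteq> {}" "W2 \<subseteq> W" and "W1 \<inter> W2 = {}"
proof -
  obtain x where x: "x \<in> W" using assms(4) by blast
  have WT: "W \<subseteq> topspace T" using assms(3) by (rule openin_subset)
  have "W \<noteq> {x}" using assms(2,3) x WT unfolding no_isolated_points_def by blast
  then obtain y where y: "y \<in> W" "y \<noteq> x" using x by blast
  obtain A B where AB: "openin T A" "openin T B" "x \<in> A" "y \<in> B" "disjnt A B"
    using assms(1) x y WT unfolding Hausdorff_space_def by (metis subsetD)
  show thesis
  proof
    show "openin T (A \<inter> W)" "openin T (B \<inter> W)"
      using AB(1,2) assms(3) by auto
    show "A \<inter> W \<noteq> {}" "B \<inter> W \<noteq> {}" "(A \<inter> W) \<inter> (B \<inter> W) = {}"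
      using AB(3-5) x y unfolding disjnt_def by blast+
  qed auto
qed

text \<open>
  A chain of length zero joins \<open>U\<close> to \<open>V\<close> only if they meet, so it suffices to shrink them to
  disjoint non-empty open sets: a chain between the smaller sets has positive length and also
  joins \<open>U\<close> to \<open>V\<close>.
\<close>

lemma open_sets_joined_positive:
  assumes "Hausdorff_space T" "no_isolated_points T"
  shows "open_sets_joined T UNIV G \<longleftrightarrow> open_sets_joined T {0<..} G"
proof
  assume joined: "open_sets_joined T UNIV G"
  show "open_sets_joined T {0<..} G"
    unfolding open_sets_joined_def
  proof (intro allI impI, elim conjE)
    fix U V assume UV: "openin T U" "U \<noteq> {}" "openin T V" "V \<noteq> {}"
    obtain U' V' where U'V': "openin T U'" "U' \<noteq> {}" "U' \<subseteq> U"
        "openin T V'" "V' \<noteq> {}" "V' \<subseteq> V" "U' \<inter> V' = {}"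
    proof (cases "U \<inter> V = {}")
      case True
      then show thesis using that UV by blast
    next
      case False
      have "openin T (U \<inter> V)" using UV by blast
      then obtain W1 W2 where "openin T W1" "W1 \<noteq> {}" "W1 \<subseteq> U \<inter> V"
          "openin T W2" "W2 \<noteq> {}" "W2 \<subseteq> U \<inter> V" "W1 \<inter> W2 = {}"
        using disjoint_open_subsets[OF assms _ False] by metis
      then show thesis using that[of W1 W2] by blast
    qed
    obtain n where n: "iter_image G n U' \<inter> V' \<noteq> {}"
      using joined U'V'(1,2,4,5) unfolding open_sets_joined_def by fast
    have "n \<noteq> 0" using n U'V'(7) by (auto simp: iter_image_eq_relpow)
    moreover have "iter_image G n U \<inter> V \<noteq> {}"
      using n U'V'(6) iter_image_mono[OF U'V'(3)] by blast
    ultimately show "\<exists>n\<in>{0<..}. iter_image G n U \<inter> V \<noteq> {}" by auto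
  qed
next
  show "open_sets_joined T UNIV G" if "open_sets_joined T {0<..} G"
    using that unfolding open_sets_joined_def by (meson UNIV_I)
qed

theorem theorem7p5:
  fixes X :: "'a set" and d :: "'a \<Rightarrow> 'a \<Rightarrow> real" and G :: "('a \<times> 'a) set"
  assumes "CR_dynamical_system X d G"
  shows
    "let T = Metric_space.mtopology X d;
         S1 = CR_dynamical_system.CR_transitive X d G;
         S2 = (\<forall>U V. openin T U \<and> U \<noteq> {} \<and> openin T V \<and> V \<noteq> {} \<longrightarrow>
                 (\<exists>n>0. iter_image G n U \<inter> V \<noteq> {}));
         S3 = (\<forall>U. openin T U \<and> U \<noteq> {} \<longrightarrow>
                 dense_in_space T (\<Union>k\<in>{0..}. iter_image G k U));
         S4 = (\<forall>U. openin T U \<and> U \<noteq> {} \<longrightarrow>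
                 dense_in_space T (\<Union>k\<in>{1..}. iter_image G k U));
         S5 = (\<forall>U V. openin T U \<and> U \<noteq> {} \<and> openin T V \<and> V \<noteq> {} \<longrightarrow>
                 (\<exists>n. iter_image (G\<inverse>) n U \<inter> V \<noteq> {}));
         S6 = (\<forall>U V. openin T U \<and> U \<noteq> {} \<and> openin T V \<and> V \<noteq> {} \<longrightarrow>
                 (\<exists>n>0. iter_image (G\<inverse>) n U \<inter> V \<noteq> {}));
         S7 = (\<forall>U. openin T U \<and> U \<noteq> {} \<longrightarrow>
                 dense_in_space T (\<Union>k\<in>{0..}. iter_image (G\<inverse>) k U));
         S8 = (\<forall>U. openin T U \<and> U \<noteq> {} \<longrightarrow>
                 dense_in_space T (\<Union>k\<in>{1..}. iter_image (G\<inverse>) k U))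
     in ((S1 \<longleftrightarrow> S3) \<and> (S1 \<longleftrightarrow> S5) \<and> (S1 \<longleftrightarrow> S7)) \<and>
        ((S2 \<longleftrightarrow> S4) \<and> (S2 \<longleftrightarrow> S6) \<and> (S2 \<longleftrightarrow> S8)) \<and>
        (no_isolated_points T \<longrightarrow>
           (S1 \<longleftrightarrow> S2) \<and> (S1 \<longleftrightarrow> S3) \<and> (S1 \<longleftrightarrow> S4) \<and> (S1 \<longleftrightarrow> S5) \<and>
           (S1 \<longleftrightarrow> S6) \<and> (S1 \<longleftrightarrow> S7) \<and> (S1 \<longleftrightarrow> S8))"
proof -
  interpret CR_dynamical_system X d G by (rule assms)
  have all_lengths: "{0..} = (UNIV :: nat set)" and positive_lengths: "{1..} = {0::nat<..}"
    by auto
  have transitive_iff: "CR_transitive \<longleftrightarrow> open_sets_joined mtopology UNIV G"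
    unfolding CR_transitive_def open_sets_joined_def by simp
  have joined_UNIV_iff: "(\<forall>U V. openin T U \<and> U \<noteq> {} \<and> openin T V \<and> V \<noteq> {} \<longrightarrow>
      (\<exists>n. iter_image H n U \<inter> V \<noteq> {})) \<longleftrightarrow> open_sets_joined T UNIV H"
    for T and H :: "('a \<times> 'a) set"
    unfolding open_sets_joined_def by simp
  have joined_positive_iff: "(\<forall>U V. openin T U \<and> U \<noteq> {} \<and> openin T V \<and> V \<noteq> {} \<longrightarrow>
      (\<exists>n>0. iter_image H n U \<inter> V \<noteq> {})) \<longleftrightarrow> open_sets_joined T {0<..} H"
    for T and H :: "('a \<times> 'a) set"
    unfolding open_sets_joined_def by (simp add: Bex_def)
  show ?thesis
    unfolding Let_def all_lengths positive_lengths transitive_iff dense_iter_images_iff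
      joined_UNIV_iff joined_positive_iff open_sets_joined_converse_iff
    using open_sets_joined_positive[OF Hausdorff_space_mtopology] by blast
qed

end
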